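(* Let $1\le\theta<\log_2 3$ be a real number and define $a_n=\lfloor n\theta\rfloor-\lfloor(n-1)\theta\rfloor$ for $n\ge1$. Then the E-sequence $(a_n)_{n\ge1}$ is $\Omega$-divergent.
   Context: An E-sequence is any infinite sequence $(a_n)_{n\ge1}$ of positive integers. For an odd positive integer $x$, its E-sequence is defined by $x_0=x$ and, for $n\ge1$, $x_n=\frac{3x_{n-1}+1}{2^{a_n}}$, where $a_n$ is the exponent of the largest power of $2$ dividing $3x_{n-1}+1$. An E-sequence is $\Omega$-divergent if it is not the E-sequence of any odd positive integer. *)

theory Defs
  imports Complex_Main "HOL-Computational_Algebra.Primes"
begin

text \<open>Sequences \<open>(a\<^sub>n)\<close> with \<open>n \<ge> 1\<close> are functions on \<open>nat\<close> whose value at \<open>0\<close> is irrelevant.\<close>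

definition E_sequence :: "(nat \<Rightarrow> int) \<Rightarrow> bool" where
  "E_sequence a \<longleftrightarrow> (\<forall>n\<ge>1. a n > 0)"

text \<open>The iterates \<open>x\<^sub>n\<close>; the division by the power of two is exact.\<close>

primrec E_iter :: "nat \<Rightarrow> nat \<Rightarrow> nat" where
  "E_iter x 0 = x"
| "E_iter x (Suc n) = (3 * E_iter x n + 1) div 2 ^ multiplicity 2 (3 * E_iter x n + 1)"

definition E_seq_of :: "nat \<Rightarrow> nat \<Rightarrow> int" where
  "E_seq_of x n = int (multiplicity 2 (3 * E_iter x (n - 1) + 1))"

definition Omega_divergent :: "(nat \<Rightarrow> int) \<Rightarrow> bool" where
  "Omega_divergent a \<longleftrightarrow>
     E_sequence a \<and> \<not> (\<exists>x::nat. odd x \<and> (\<forall>n\<ge>1. a n = E_seq_of x n))"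

end

theory Submission
  imports Defs "HOL-Analysis.Kronecker_Approximation_Theorem"
begin

text \<open>
  Suppose that \<open>(a\<^sub>n)\<close> is the E-sequence of \<open>x\<close>. There are arbitrarily large \<open>q\<close> with
  \<open>\<lfloor>(i + q)\<theta>\<rfloor> - \<lfloor>i\<theta>\<rfloor>\<close> independent of \<open>i\<close> for \<open>1 \<le> i < q\<close>: the multiples of the denominator if
  \<open>\<theta>\<close> is rational, and otherwise the \<open>q\<close> for which \<open>q\<theta>\<close> is closer to an integer than every
  earlier \<open>i\<theta>\<close>. For such \<open>q\<close> the E-sequences of \<open>x\<^sub>1\<close> and \<open>x\<^bsub>q+1\<^esub>\<close> agree in the first \<open>q - 2\<close> terms,
  which forces \<open>x\<^sub>1 \<equiv> x\<^bsub>q+1\<^esub>\<close> modulo \<open>2\<^bsup>q-2\<^esup>\<close>. But \<open>x\<^bsub>q+1\<^esub>\<close> is at most of order \<open>(3/2)\<^bsup>q\<^esup>\<close>, so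
  \<open>x\<^sub>1 = x\<^bsub>q+1\<^esub>\<close> for large \<open>q\<close>, whereas \<open>x\<^bsub>q+1\<^esub>\<close> is at least of order \<open>(3/2\<^bsup>\<theta>\<^esup>)\<^bsup>q\<^esup>\<close>, which is unbounded.
\<close>

text \<open>Moving \<open>y\<close> by \<open>z - p\<close> crosses no integer, since every integer
  lies farther from \<open>y\<close> than that.\<close>

lemma floor_add_of_int_approx:
  fixes y z :: real and p :: int
  assumes far: "\<And>k::int. \<bar>z - p\<bar> < \<bar>y - k\<bar>"
  shows "\<lfloor>y + z\<rfloor> = \<lfloor>y\<rfloor> + p"
proof -
  have "\<bar>z - p\<bar> < y - \<lfloor>y\<rfloor>"
    using far[of "\<lfloor>y\<rfloor>"] by linarith
  moreover have "\<bar>z - p\<bar> < \<lfloor>y\<rfloor> + 1 - y"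
    using far[of "\<lfloor>y\<rfloor> + 1"] by linarith
  ultimately show ?thesis
    by (intro floor_unique) (simp_all add: abs_less_iff)
qed

lemma ex_small_dist_multiple:
  fixes \<theta> \<epsilon> :: real
  assumes "\<epsilon> > 0"
  shows "\<exists>q\<ge>1. \<exists>p::int. \<bar>real q * \<theta> - p\<bar> < \<epsilon>"
proof -
  obtain N :: nat where N: "1 / \<epsilon> < N"
    using reals_Archimedean2 by blast
  have "N > 0"
    using N assms by (metis divide_pos_pos gr0I less_asym of_nat_0 zero_less_one)
  then obtain h k :: int where hk: "0 < k" "\<bar>of_int k * \<theta> - of_int h\<bar> < 1 / N"
    using Dirichlet_approx[of N \<theta>] by blast
  have "1 / N < \<epsilon>"
    using N assms \<open>N > 0\<close> by (simp add: field_simps)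
  with hk have "nat k \<ge> 1" "\<bar>real (nat k) * \<theta> - h\<bar> < \<epsilon>"
    by auto
  then show ?thesis by blast
qed

lemma ex_large_floor_shift:
  fixes \<theta> :: real and N :: nat
  shows "\<exists>q\<ge>N. \<exists>p::int. \<forall>i. 1 \<le> i \<and> i < q \<longrightarrow>
    \<lfloor>real (i + q) * \<theta>\<rfloor> = \<lfloor>real i * \<theta>\<rfloor> + p"
proof (cases "\<exists>d\<ge>1. \<exists>k::int. real d * \<theta> = k")
  case True
  then obtain d :: nat and k :: int where d: "d \<ge> 1" "real d * \<theta> = k"
    by blast
  have "\<lfloor>real (i + N * d) * \<theta>\<rfloor> = \<lfloor>real i * \<theta>\<rfloor> + int N * k" for i
  proof -
    have "real (i + N * d) * \<theta> = real i * \<theta> + real N * (real d * \<theta>)"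
      by (simp add: algebra_simps)
    also have "\<dots> = real i * \<theta> + of_int (int N * k)"
      by (simp add: d(2))
    finally show ?thesis
      by (simp only: floor_add_int)
  qed
  moreover have "N * d \<ge> N"
    using d by simp
  ultimately show ?thesis by blast
next
  case False
  \<comment> \<open>No multiple \<open>i * \<theta>\<close> with \<open>1 \<le> i \<le> N\<close>
    comes within \<open>\<epsilon>\<close> of an integer, so any \<open>q\<close> that does exceeds
    \<open>N\<close>. The element \<open>1\<close> keeps the set nonempty when
    \<open>N = 0\<close>.\<close>
  define \<epsilon> where "\<epsilon> = Min (insert 1 ((\<lambda>i. \<bar>real i * \<theta> - round (real i * \<theta>)\<bar>) ` {1..N}))"
  have "\<epsilon> > 0"
    unfolding \<epsilon>_def using False by (subst Min_gr_iff) auto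
  have \<epsilon>_le: "\<epsilon> \<le> \<bar>real i * \<theta> - k\<bar>" if "1 \<le> i" "i \<le> N" for i and k :: int
  proof -
    have "\<epsilon> \<le> \<bar>real i * \<theta> - round (real i * \<theta>)\<bar>"
      unfolding \<epsilon>_def using that by (intro Min_le) auto
    also have "\<dots> \<le> \<bar>real i * \<theta> - k\<bar>"
      by (rule round_diff_minimal)
    finally show ?thesis .
  qed
  define P where "P q \<longleftrightarrow> q \<ge> 1 \<and> (\<exists>p::int. \<bar>real q * \<theta> - p\<bar> < \<epsilon>)" for q :: nat
  define q where "q = (LEAST q. P q)"
  have "P q"
    unfolding q_def using ex_small_dist_multiple[OF \<open>\<epsilon> > 0\<close>, of \<theta>] by (metis LeastI P_def)
  then obtain p :: int where p: "q \<ge> 1" "\<bar>real q * \<theta> - p\<bar> < \<epsilon>"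
    by (auto simp: P_def)
  have "q > N"
    using \<epsilon>_le[OF p(1)] p(2) by (meson not_le)
  moreover have "\<lfloor>real (i + q) * \<theta>\<rfloor> = \<lfloor>real i * \<theta>\<rfloor> + p" if "1 \<le> i" "i < q" for i
  proof -
    have "\<not> P i"
      using that(2) not_less_Least unfolding q_def by blast
    then have "\<bar>real q * \<theta> - p\<bar> < \<bar>real i * \<theta> - k\<bar>" for k :: int
      using p(2) that(1) unfolding P_def by (meson less_le_trans not_le)
    from floor_add_of_int_approx[OF this] show ?thesis
      by (simp add: distrib_right)
  qed
  ultimately show ?thesis by (meson less_imp_le)
qed

lemma E_iter_step:
  "2 ^ multiplicity 2 (3 * E_iter x n + 1) * E_iter x (Suc n) = 3 * E_iter x n + 1"
  by (simp only: E_iter.simps dvd_mult_div_cancel[OF multiplicity_dvd])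

lemma E_iter_add: "E_iter x (n + k) = E_iter (E_iter x n) k"
  by (induction k) simp_all

text \<open>Subtracting two steps with the same exponent \<open>c\<close> cancels the
  \<open>+ 1\<close>: the difference is multiplied by 3 and divided by \<open>2 ^ c\<close>. After
  \<open>m\<close> steps the exponents add up to some \<open>s \<ge> m\<close>, and
  \<open>3 ^ m\<close> is odd.\<close>

lemma E_iter_cong_of_eq_prefix:
  assumes eq: "\<And>n. n < m \<Longrightarrow>
      multiplicity 2 (3 * E_iter x n + 1) = multiplicity 2 (3 * E_iter y n + 1)"
    and pos: "\<And>n. n < m \<Longrightarrow> multiplicity 2 (3 * E_iter x n + 1) \<ge> 1"
  shows "(2::int) ^ m dvd int x - int y"
proof -
  let ?X = "\<lambda>n. int (E_iter x n)" and ?Y = "\<lambda>n. int (E_iter y n)"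
  have "\<exists>s\<ge>k. 2 ^ s * (?X k - ?Y k) = 3 ^ k * (int x - int y)" if "k \<le> m" for k
    using that
  proof (induction k)
    case 0
    then show ?case by auto
  next
    case (Suc k)
    then obtain s where s: "s \<ge> k" "2 ^ s * (?X k - ?Y k) = 3 ^ k * (int x - int y)"
      by auto
    define c where "c = multiplicity 2 (3 * E_iter x k + 1)"
    have "2 ^ c * ?X (Suc k) = 3 * ?X k + 1"
      using arg_cong[OF E_iter_step[of x k], of int] unfolding c_def
      by (simp only: of_nat_mult of_nat_power of_nat_add of_nat_numeral of_nat_1)
    moreover have "2 ^ c * ?Y (Suc k) = 3 * ?Y k + 1"
      using arg_cong[OF E_iter_step[of y k], of int] eq[of k] Suc.prems unfolding c_def
      by (simp only: of_nat_mult of_nat_power of_nat_add of_nat_numeral of_nat_1 Suc_le_eq)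
    ultimately have "2 ^ c * (?X (Suc k) - ?Y (Suc k)) = 3 * (?X k - ?Y k)"
      by (simp only: right_diff_distrib)
    then have "2 ^ (s + c) * (?X (Suc k) - ?Y (Suc k)) = 3 * (2 ^ s * (?X k - ?Y k))"
      by (simp only: power_add mult.assoc mult.left_commute)
    also have "\<dots> = 3 ^ Suc k * (int x - int y)"
      unfolding s(2) by simp
    finally show ?case
      using s(1) pos[of k] Suc.prems unfolding c_def[symmetric]
      by (intro exI[of _ "s + c"]) auto
  qed
  then obtain s where "s \<ge> m" "2 ^ s * (?X m - ?Y m) = 3 ^ m * (int x - int y)"
    by blast
  then have "(2::int) ^ m dvd 3 ^ m * (int x - int y)"
    by (metis dvd_triv_left le_imp_power_dvd dvd_trans)
  then show ?thesis
    by (simp add: coprime_dvd_mult_right_iff)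
qed

text \<open>Each step divides by at least 2, and
  \<open>(3 * t + 1) / 2 + 1 = 3 / 2 * (t + 1)\<close>.\<close>

lemma E_iter_upper_bound:
  assumes "\<And>n. multiplicity 2 (3 * E_iter x n + 1) \<ge> 1"
  shows "real (E_iter x n) + 1 \<le> (3 / 2) ^ n * (real x + 1)"
proof (induction n)
  case (Suc n)
  have "2 * E_iter x (Suc n) \<le> 2 ^ multiplicity 2 (3 * E_iter x n + 1) * E_iter x (Suc n)"
    using power_increasing[OF assms[of n], of "2::nat"] by (intro mult_right_mono) simp_all
  then have "2 * E_iter x (Suc n) \<le> 3 * E_iter x n + 1"
    by (simp only: E_iter_step)
  then have "2 * real (E_iter x (Suc n)) \<le> 3 * real (E_iter x n) + 1"
    by linarith
  with Suc show ?case
    by simp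
qed simp

text \<open>Each step only gains from the \<open>+ 1\<close>, which is dropped.\<close>

lemma E_iter_lower_bound:
  "3 ^ n * x \<le> 2 ^ (\<Sum>i<n. multiplicity 2 (3 * E_iter x i + 1)) * E_iter x n"
proof (induction n)
  case (Suc n)
  let ?S = "\<Sum>i<n. multiplicity 2 (3 * E_iter x i + 1)"
  have "3 ^ Suc n * x \<le> 2 ^ ?S * (3 * E_iter x n + 1)"
    using Suc by simp
  also have "\<dots> = 2 ^ ?S * (2 ^ multiplicity 2 (3 * E_iter x n + 1) * E_iter x (Suc n))"
    by (simp only: E_iter_step)
  finally show ?case
    by (simp only: sum.lessThan_Suc power_add mult.assoc)
qed simp

theorem theorem4p14:
  fixes \<theta> :: real and a :: "nat \<Rightarrow> int"
  assumes "1 \<le> \<theta>" and "\<theta> < log 2 3"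
    and "\<And>n. n \<ge> 1 \<Longrightarrow> a n = \<lfloor>real n * \<theta>\<rfloor> - \<lfloor>(real n - 1) * \<theta>\<rfloor>"
  shows "Omega_divergent a"
proof -
  have a_pos: "a n > 0" if "n \<ge> 1" for n
  proof -
    have "\<lfloor>(real n - 1) * \<theta> + 1\<rfloor> \<le> \<lfloor>real n * \<theta>\<rfloor>"
      using assms(1) by (intro floor_mono) (simp add: algebra_simps)
    then show ?thesis
      using assms(3)[OF that] by linarith
  qed
  moreover have False if "odd x" and x: "\<forall>n\<ge>1. a n = E_seq_of x n" for x :: nat
  proof -
    define b where "b n = multiplicity 2 (3 * E_iter x n + 1)" for n
    have b: "int (b n) = \<lfloor>real (Suc n) * \<theta>\<rfloor> - \<lfloor>real n * \<theta>\<rfloor>" for n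
      using x[rule_format, of "Suc n"] assms(3)[of "Suc n"] by (simp add: E_seq_of_def b_def)
    have b_pos: "b n \<ge> 1" for n
      using x[rule_format, of "Suc n"] a_pos[of "Suc n"] by (simp add: E_seq_of_def b_def)
    have sum_b: "int (\<Sum>i<n. b i) = \<lfloor>real n * \<theta>\<rfloor>" for n
      by (induction n) (simp_all add: b)
    \<comment> \<open>The growth rate of the lower bound; \<open>\<theta> < log 2 3\<close> makes it
      exceed 1.\<close>
    define r where "r = 3 / 2 powr \<theta>"
    have "2 powr \<theta> < 3"
      using assms(2) by (simp add: less_log_iff)
    then have "r > 1"
      by (simp add: r_def)
    have lower: "r ^ n \<le> real (E_iter x n)" for n
    proof -
      have "real (\<Sum>i<n. b i) \<le> real n * \<theta>"
        using sum_b[of n] by linarith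
      then have "2 powr real (\<Sum>i<n. b i) \<le> 2 powr (real n * \<theta>)"
        by simp
      then have two: "2 ^ (\<Sum>i<n. b i) \<le> (2 powr \<theta>) ^ n"
        by (simp only: powr_realpow zero_less_numeral powr_power mult.commute)
      have "1 \<le> x"
        using \<open>odd x\<close> by (cases x) auto
      then have "3 ^ n * 1 \<le> 3 ^ n * x"
        by simp
      also have "\<dots> \<le> 2 ^ (\<Sum>i<n. b i) * E_iter x n"
        unfolding b_def by (rule E_iter_lower_bound)
      finally have "real (3 ^ n * 1) \<le> real (2 ^ (\<Sum>i<n. b i) * E_iter x n)"
        by (simp only: of_nat_le_iff)
      then have "3 ^ n \<le> 2 ^ (\<Sum>i<n. b i) * real (E_iter x n)"
        by simp
      also have "\<dots> \<le> (2 powr \<theta>) ^ n * real (E_iter x n)"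
        using two by (intro mult_right_mono) simp_all
      finally show ?thesis
        by (simp add: r_def power_divide field_simps)
    qed
    obtain N1 where N1: "real (E_iter x 1) < r ^ N1"
      using real_arch_pow[OF \<open>r > 1\<close>] by blast
    \<comment> \<open>Here \<open>4 / 3\<close> is 2 divided by \<open>3 / 2\<close>, and 6 is
      \<open>4 * (3 / 2)\<close>, which pays for the exponents \<open>q - 2\<close> and
      \<open>q + 1\<close> below.\<close>
    obtain N2 where N2: "6 * (real x + 1) < (4 / 3) ^ N2"
      using real_arch_pow[of "4 / 3"] by auto
    obtain q p where q: "q \<ge> N1 + N2 + 2"
      and p: "\<And>i. 1 \<le> i \<Longrightarrow> i < q \<Longrightarrow> \<lfloor>real (i + q) * \<theta>\<rfloor> = \<lfloor>real i * \<theta>\<rfloor> + p"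
      using ex_large_floor_shift[of "N1 + N2 + 2" \<theta>] by blast
    have "b (q + 1 + n) = b (1 + n)" if "n < q - 2" for n
      using b[of "q + 1 + n"] b[of "1 + n"] p[of "1 + n"] p[of "2 + n"] that
      by (simp add: ac_simps)
    then have dvd: "(2::int) ^ (q - 2) dvd int (E_iter x (q + 1)) - int (E_iter x 1)"
      using b_pos
      by (intro E_iter_cong_of_eq_prefix) (simp_all only: E_iter_add[symmetric] b_def)
    have "r ^ N1 \<le> r ^ (q + 1)"
      using q \<open>r > 1\<close> by (intro power_increasing) auto
    then have gt: "E_iter x 1 < E_iter x (q + 1)"
      using N1 lower[of "q + 1"] by linarith
    have "(4 / 3 :: real) ^ N2 \<le> (4 / 3) ^ q"
      using q by (intro power_increasing) auto
    with N2 have "6 * (real x + 1) < (4 / 3) ^ q"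
      by (rule less_le_trans)
    then have "(3 / 2) ^ q * (6 * (real x + 1)) < (3 / 2) ^ q * (4 / 3) ^ q"
      by (rule mult_strict_left_mono) simp
    also have "\<dots> = (2::real) ^ q"
      by (simp flip: power_mult_distrib)
    also have "\<dots> = 4 * 2 ^ (q - 2)"
      using q le_add_diff_inverse[of 2 q] power_add[of "2::real" 2 "q - 2"] by auto
    finally have "(3 / 2) ^ (q + 1) * (real x + 1) < 2 ^ (q - 2)"
      by (simp add: algebra_simps)
    then have "real (E_iter x (q + 1)) < 2 ^ (q - 2)"
      using E_iter_upper_bound[OF b_pos[unfolded b_def], of "q + 1"] by linarith
    then have "int (E_iter x (q + 1)) < 2 ^ (q - 2)"
      by (metis of_nat_less_iff of_nat_numeral of_nat_power)
    \<comment> \<open>A positive multiple of \<open>2 ^ (q - 2)\<close> is at least that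
      large.\<close>
    moreover have "2 ^ (q - 2) \<le> int (E_iter x (q + 1)) - int (E_iter x 1)"
      using dvd gt by (intro zdvd_imp_le) auto
    ultimately show False
      by linarith
  qed
  ultimately show ?thesis
    unfolding Omega_divergent_def E_sequence_def by blast
qed

end
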